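(* In LP$^{\mathrm{MLN}}$ (i.e. with respect to semi-strong equivalence $\equiv_{s,s}$): the S-RD-1 transformation is neither SE-preserving nor NSE-preserving; and the S-RD-2 transformation is SE-preserving but not NSE-preserving.
   Context: Atoms are propositional. A rule $r$ is an expression $h_1\vee\cdots\vee h_k\leftarrow b_1,\dots,b_m,\mathit{not}\,c_1,\dots,\mathit{not}\,c_n$; write $H(r)$, $B^+(r)$, $B^-(r)$ for the sets of head, positive body and negative body atoms. A program is a finite set of rules. An interpretation $X$ satisfies $r$ iff $X\cap H(r)\neq\emptyset$ or $B^+(r)\not\subseteq X$ or $B^-(r)\cap X\neq\emptyset$. GL-reduct $P^X=\{H(r)\leftarrow B^+(r) : r\in P,\ B^-(r)\cap X=\emptyset\}$; $X$ is an ASP stable model of $P$ iff $X\models P^X$ and no proper subset of $X$ satisfies $P^X$. Weights of LP$^{\mathrm{MLN}}$ rules are omitted; $X$ is an LP$^{\mathrm{MLN}}$ stable model of $P$ iff $X$ is an ASP stable model of $\{r\in P: X\models r\}$. $P\equiv_{s,s}Q$ iff for every program $R$, $P\cup R$ and $Q\cup R$ have the same LP$^{\mathrm{MLN}}$ stable models. Programs are regarded as tuples of rules; $\langle P,Q\rangle$ is the concatenation. For a tuple $T=\langle r_1,\dots,r_n\rangle$ let $\langle S_1,\dots,S_{3n}\rangle=\langle H(r_1),B^+(r_1),B^-(r_1),\dots,H(r_n),B^+(r_n),B^-(r_n)\rangle$; for nonempty $N'\subseteq\{1,\dots,3n\}$ the independent set is $I_{N'}=\bigcap_{i\in N'}S_i\setminus\bigcup_{j\notin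 N'}S_j$. For $i\in\{1,2\}$, the S-RD-$i$ transformation deletes some atom $a\in I$ from an independent set $I$ with $|I|=i$, i.e. removes $a$ from every rule of $T$. For a pair $T=\langle P,Q\rangle$ the result is $\langle P^\circ,Q^\circ\rangle$ with $P^\circ$ the first $|P|$ rules. A transformation type is SE-preserving if for every pair $\langle P,Q\rangle$ and every admissible application $P\equiv_{s,s}Q$ implies $P^\circ\equiv_{s,s}Q^\circ$, and NSE-preserving if $P\not\equiv_{s,s}Q$ implies $P^\circ\not\equiv_{s,s}Q^\circ$. *)

theory Defs
  imports Main "HOL-Library.FSet"
begin

datatype 'a lprule = LPRule (H: "'a fset") (Bpos: "'a fset") (Bneg: "'a fset")

text \<open>
  Programs are tuples of rules, rendered as lists; the semantics only looks at the underlying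
  finite set of rules.
\<close>

type_synonym 'a program = "'a lprule list"

definition sat_rule :: "'a set \<Rightarrow> 'a lprule \<Rightarrow> bool" where
  "sat_rule X r \<longleftrightarrow>
     X \<inter> fset (H r) \<noteq> {} \<or> \<not> fset (Bpos r) \<subseteq> X \<or> fset (Bneg r) \<inter> X \<noteq> {}"

definition sat :: "'a set \<Rightarrow> 'a lprule set \<Rightarrow> bool" where
  "sat X P \<longleftrightarrow> (\<forall>r\<in>P. sat_rule X r)"

definition GL_reduct :: "'a lprule set \<Rightarrow> 'a set \<Rightarrow> 'a lprule set" where
  "GL_reduct P X = {LPRule (H r) (Bpos r) {||} | r. r \<in> P \<and> fset (Bneg r) \<inter> X = {}}"

definition ASP_stable :: "'a set \<Rightarrow> 'a lprule set \<Rightarrow> bool" where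
  "ASP_stable X P \<longleftrightarrow> sat X (GL_reduct P X) \<and> (\<forall>Y. Y \<subset> X \<longrightarrow> \<not> sat Y (GL_reduct P X))"

definition LPMLN_stable :: "'a set \<Rightarrow> 'a lprule set \<Rightarrow> bool" where
  "LPMLN_stable X P \<longleftrightarrow> ASP_stable X {r \<in> P. sat_rule X r}"

definition semi_strong_equiv :: "'a program \<Rightarrow> 'a program \<Rightarrow> bool" (infix "\<equiv>\<^sub>s\<^sub>s" 50) where
  "P \<equiv>\<^sub>s\<^sub>s Q \<longleftrightarrow>
     (\<forall>R :: 'a program. \<forall>X. LPMLN_stable X (set P \<union> set R) \<longleftrightarrow> LPMLN_stable X (set Q \<union> set R))"

definition comp_sets :: "'a lprule list \<Rightarrow> 'a set list" where
  "comp_sets T = concat (map (\<lambda>r. [fset (H r), fset (Bpos r), fset (Bneg r)]) T)"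

text \<open>The positions \<open>1, \<dots>, 3n\<close> are shifted to \<open>0, \<dots>, 3n - 1\<close>.\<close>

definition indep_set :: "'a lprule list \<Rightarrow> nat set \<Rightarrow> 'a set" where
  "indep_set T N' =
     (\<Inter>i\<in>N'. comp_sets T ! i) - (\<Union>j\<in>{..<3 * length T} - N'. comp_sets T ! j)"

definition is_indep_set :: "'a lprule list \<Rightarrow> 'a set \<Rightarrow> bool" where
  "is_indep_set T I \<longleftrightarrow> (\<exists>N'. N' \<noteq> {} \<and> N' \<subseteq> {..<3 * length T} \<and> I = indep_set T N')"

definition del_atom :: "'a \<Rightarrow> 'a lprule \<Rightarrow> 'a lprule" where
  "del_atom a r = LPRule (H r |-| {|a|}) (Bpos r |-| {|a|}) (Bneg r |-| {|a|})"

text \<open>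
  A transformation type is the relation between a pair of programs and the possible results of an
  admissible application.
\<close>

type_synonym 'a transformation = "'a program \<times> 'a program \<Rightarrow> 'a program \<times> 'a program \<Rightarrow> bool"

definition S_RD :: "nat \<Rightarrow> 'a transformation" where
  "S_RD i = (\<lambda>(P, Q) (P', Q').
     \<exists>I a. is_indep_set (P @ Q) I \<and> card I = i \<and> a \<in> I \<and>
       P' = take (length P) (map (del_atom a) (P @ Q)) \<and>
       Q' = drop (length P) (map (del_atom a) (P @ Q)))"

definition SE_preserving :: "'a transformation \<Rightarrow> bool" where
  "SE_preserving \<tau> \<longleftrightarrow>
     (\<forall>P Q P' Q'. \<tau> (P, Q) (P', Q') \<longrightarrow> P \<equiv>\<^sub>s\<^sub>s Q \<longrightarrow> P' \<equiv>\<^sub>s\<^sub>s Q')"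

definition NSE_preserving :: "'a transformation \<Rightarrow> bool" where
  "NSE_preserving \<tau> \<longleftrightarrow>
     (\<forall>P Q P' Q'. \<tau> (P, Q) (P', Q') \<longrightarrow> \<not> P \<equiv>\<^sub>s\<^sub>s Q \<longrightarrow> \<not> P' \<equiv>\<^sub>s\<^sub>s Q')"

end

theory Submission imports Defs begin

text \<open>
  Semi-strong equivalence is governed by SE-models: \<open>P\<close> and \<open>Q\<close> are equivalent iff for all
  \<open>Y \<subseteq> X\<close> some rule of \<open>P\<close> is refuted by \<open>(Y, X)\<close> exactly when some rule of \<open>Q\<close> is, where \<open>(Y, X)\<close>
  refutes a rule if \<open>X\<close> satisfies it but \<open>Y\<close> violates its reduct. If \<open>a\<close> and \<open>c\<close> occur at the same
  positions, then deleting \<open>a\<close> does not change what is refuted by pairs in which \<open>a\<close> has the same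
  status as \<open>c\<close>, and every pair can be brought into this form without touching the remaining atoms;
  this gives SE-preservation of S-RD-2. The negative claims are witnessed by small programs.
\<close>

definition refutes :: "'a set \<Rightarrow> 'a set \<Rightarrow> 'a lprule \<Rightarrow> bool" where
  "refutes Y X r \<longleftrightarrow> fset (Bneg r) \<inter> X = {} \<and> fset (Bpos r) \<subseteq> Y \<and> fset (H r) \<inter> Y = {}
     \<and> fset (H r) \<inter> X \<noteq> {}"

definition atoms :: "'a lprule set \<Rightarrow> 'a set" where
  "atoms P = (\<Union>r\<in>P. fset (H r) \<union> fset (Bpos r) \<union> fset (Bneg r))"

lemma finite_atoms: "finite P \<Longrightarrow> finite (atoms P)"
  by (auto simp: atoms_def)

text \<open>\<open>X\<close> always satisfies the reduct of the rules it satisfies, so only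
  minimality remains. For \<open>Y \<subset> X\<close> a true body in \<open>Y\<close> is true in
  \<open>X\<close>, so satisfaction by \<open>X\<close> then means that \<open>X\<close> meets the
  head.\<close>

lemma LPMLN_stable_iff_refutes:
  "LPMLN_stable X P \<longleftrightarrow> (\<forall>Y. Y \<subset> X \<longrightarrow> (\<exists>r\<in>P. refutes Y X r))"
proof -
  have "sat X (GL_reduct {r \<in> P. sat_rule X r} X)"
    by (auto simp: sat_def GL_reduct_def sat_rule_def)
  moreover have "\<not> sat Y (GL_reduct {r \<in> P. sat_rule X r} X) \<longleftrightarrow> (\<exists>r\<in>P. refutes Y X r)"
    if "Y \<subset> X" for Y
  proof -
    have "(sat_rule X r \<and> fset (Bneg r) \<inter> X = {} \<and> \<not> sat_rule Y (LPRule (H r) (Bpos r) {||}))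
        \<longleftrightarrow> refutes Y X r" for r
      using that unfolding sat_rule_def refutes_def by auto
    then show ?thesis
      unfolding sat_def GL_reduct_def by blast
  qed
  ultimately show ?thesis
    unfolding LPMLN_stable_def ASP_stable_def by blast
qed

lemma refutes_Int_atoms:
  assumes "r \<in> P" "atoms P \<subseteq> A"
  shows "refutes (Y \<inter> A) (X \<inter> A) r \<longleftrightarrow> refutes Y X r"
proof -
  have "fset (H r) \<subseteq> A" "fset (Bpos r) \<subseteq> A" "fset (Bneg r) \<subseteq> A"
    using assms by (auto simp: atoms_def)
  then show ?thesis unfolding refutes_def by blast
qed

text \<open>
  The facts of \<open>Y\<close> together with all implications between atoms of \<open>X - Y\<close>: the only proper subset
  of \<open>X\<close> that satisfies them is \<open>Y\<close>.
\<close>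

lemma ex_separating_program:
  assumes "finite X" "Y \<subset> X"
  shows "\<exists>R :: 'a program. \<forall>Z. Z \<subset> X \<longrightarrow> (\<exists>r\<in>set R. refutes Z X r) \<longleftrightarrow> Z \<noteq> Y"
proof -
  let ?R = "(\<lambda>a. LPRule {|a|} {||} {||}) ` Y
    \<union> (\<lambda>(a, b). LPRule {|a|} {|b|} {||}) ` ((X - Y) \<times> (X - Y))"
  have "finite ?R" using assms by (auto intro: finite_subset)
  from finite_list[OF this] obtain R where R: "set R = ?R" ..
  have "(\<exists>r\<in>set R. refutes Z X r) \<longleftrightarrow> Z \<noteq> Y" if Z: "Z \<subset> X" for Z
  proof -
    have "(\<exists>r\<in>set R. refutes Z X r) \<longleftrightarrow>
        (\<exists>a\<in>Y. a \<notin> Z) \<or> (\<exists>a\<in>X - Y. \<exists>b\<in>X - Y. b \<in> Z \<and> a \<notin> Z)"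
    proof -
      have "refutes Z X (LPRule {|a|} {||} {||}) \<longleftrightarrow> a \<in> X \<and> a \<notin> Z"
        and "refutes Z X (LPRule {|a|} {|b|} {||}) \<longleftrightarrow> a \<in> X \<and> b \<in> Z \<and> a \<notin> Z" for a b
        by (auto simp: refutes_def)
      then have "(\<exists>r\<in>set R. refutes Z X r) \<longleftrightarrow> (\<exists>a\<in>Y. a \<in> X \<and> a \<notin> Z)
          \<or> (\<exists>a\<in>X - Y. \<exists>b\<in>X - Y. a \<in> X \<and> b \<in> Z \<and> a \<notin> Z)"
        unfolding R by (simp add: bex_Un)
      then show ?thesis using assms(2) by blast
    qed
    also have "\<dots> \<longleftrightarrow> Z \<noteq> Y"
    proof
      assume "Z \<noteq> Y"
      then consider a where "a \<in> Y" "a \<notin> Z" | b where "Y \<subseteq> Z" "b \<in> Z" "b \<notin> Y" by blast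
      \<comment> \<open>In the second case \<open>Y \<subseteq> Z\<close> puts this atom in
        \<open>X - Y\<close>, so the implication from \<open>b\<close> to it is refuted.\<close>
      moreover obtain a where "a \<in> X" "a \<notin> Z" using Z by blast
      ultimately show "(\<exists>a\<in>Y. a \<notin> Z) \<or> (\<exists>a\<in>X - Y. \<exists>b\<in>X - Y. b \<in> Z \<and> a \<notin> Z)"
        using Z by cases auto
    qed auto
    finally show ?thesis .
  qed
  then show ?thesis by blast
qed

text \<open>For the forward direction, a separating context refutes all proper subsets of
  \<open>X\<close> except \<open>Y\<close>; stability of \<open>X\<close> then tells whether the
  program itself refutes \<open>Y\<close>.\<close>

lemma semi_strong_equiv_iff_refutes:
  fixes P Q :: "'a program"
  shows "P \<equiv>\<^sub>s\<^sub>s Q \<longleftrightarrow>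
    (\<forall>Y X. Y \<subseteq> X \<longrightarrow> (\<exists>r\<in>set P. refutes Y X r) \<longleftrightarrow> (\<exists>r\<in>set Q. refutes Y X r))"
    (is "_ \<longleftrightarrow> ?same")
proof
  assume ?same
  then have *: "(Y \<subset> X \<longrightarrow> (\<exists>r\<in>set P \<union> set R. refutes Y X r)) \<longleftrightarrow>
      (Y \<subset> X \<longrightarrow> (\<exists>r\<in>set Q \<union> set R. refutes Y X r))" for Y X and R :: "'a program"
    by (simp add: bex_Un psubset_imp_subset)
  show "P \<equiv>\<^sub>s\<^sub>s Q"
    unfolding semi_strong_equiv_def LPMLN_stable_iff_refutes by (simp only: * simp_thms)
next
  assume equiv: "P \<equiv>\<^sub>s\<^sub>s Q"
  have fin: "(\<exists>r\<in>set P. refutes Y X r) \<longleftrightarrow> (\<exists>r\<in>set Q. refutes Y X r)"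
    if "finite X" "Y \<subseteq> X" for X Y
  proof (cases "Y = X")
    case True
    have "\<not> refutes X X r" for r unfolding refutes_def by simp
    with True show ?thesis by simp
  next
    case False
    with that have "Y \<subset> X" by auto
    obtain R :: "'a program"
      where R: "\<And>Z. Z \<subset> X \<Longrightarrow> (\<exists>r\<in>set R. refutes Z X r) \<longleftrightarrow> Z \<noteq> Y"
      using ex_separating_program[OF \<open>finite X\<close> \<open>Y \<subset> X\<close>] by blast
    have stable: "LPMLN_stable X (set S \<union> set R) \<longleftrightarrow> (\<exists>r\<in>set S. refutes Y X r)"
      for S :: "'a program"
    proof -
      have "LPMLN_stable X (set S \<union> set R) \<longleftrightarrow>
          (\<forall>Z. Z \<subset> X \<longrightarrow> Z \<noteq> Y \<or> (\<exists>r\<in>set S. refutes Z X r))"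
        unfolding LPMLN_stable_iff_refutes bex_Un using R by metis
      with \<open>Y \<subset> X\<close> show ?thesis by metis
    qed
    have "LPMLN_stable X (set P \<union> set R) \<longleftrightarrow> LPMLN_stable X (set Q \<union> set R)"
      using equiv by (simp only: semi_strong_equiv_def)
    then show ?thesis by (simp only: stable)
  qed
  \<comment> \<open>Separating programs exist only for finite \<open>X\<close>. Cutting a pair down
    to the finitely many occurring atoms does not change what it refutes.\<close>
  define A where "A = atoms (set P \<union> set Q)"
  have "finite A" unfolding A_def by (intro finite_atoms) simp
  have restrict: "refutes (Y \<inter> A) (X \<inter> A) r \<longleftrightarrow> refutes Y X r" if "r \<in> set P \<union> set Q" for Y X r
    using refutes_Int_atoms[OF that] unfolding A_def by simp
  show ?same
  proof (intro allI impI)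
    fix Y X :: "'a set" assume "Y \<subseteq> X"
    then have "(\<exists>r\<in>set P. refutes (Y \<inter> A) (X \<inter> A) r) \<longleftrightarrow> (\<exists>r\<in>set Q. refutes (Y \<inter> A) (X \<inter> A) r)"
      using \<open>finite A\<close> by (intro fin) auto
    then show "(\<exists>r\<in>set P. refutes Y X r) \<longleftrightarrow> (\<exists>r\<in>set Q. refutes Y X r)"
      by (simp add: restrict)
  qed
qed

lemma length_comp_sets: "length (comp_sets T) = 3 * length T"
  by (induction T) (auto simp: comp_sets_def)

text \<open>Every element of an independent set lies in exactly the components that its index set
  selects.\<close>

lemma indep_set_same_positions:
  assumes "is_indep_set T I" "a \<in> I" "c \<in> I" "r \<in> set T"
  shows "a |\<in>| H r \<longleftrightarrow> c |\<in>| H r" "a |\<in>| Bpos r \<longleftrightarrow> c |\<in>| Bpos r" "a |\<in>| Bneg r \<longleftrightarrow> c |\<in>| Bneg r"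
proof -
  obtain N where N: "I = indep_set T N"
    using assms(1) by (auto simp: is_indep_set_def)
  have "a \<in> S \<longleftrightarrow> c \<in> S" if S: "S \<in> set (comp_sets T)" for S
  proof -
    obtain i where i: "i < 3 * length T" "S = comp_sets T ! i"
      using S unfolding in_set_conv_nth length_comp_sets by blast
    show ?thesis
      using i assms(2,3) unfolding N indep_set_def by (cases "i \<in> N") auto
  qed
  moreover have "{fset (H r), fset (Bpos r), fset (Bneg r)} \<subseteq> set (comp_sets T)"
    using assms(4) by (auto simp: comp_sets_def)
  ultimately show "a |\<in>| H r \<longleftrightarrow> c |\<in>| H r" "a |\<in>| Bpos r \<longleftrightarrow> c |\<in>| Bpos r"
    "a |\<in>| Bneg r \<longleftrightarrow> c |\<in>| Bneg r"
    by auto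
qed

definition copy_status :: "'a \<Rightarrow> 'a \<Rightarrow> 'a set \<Rightarrow> 'a set" where
  "copy_status c a X = (if c \<in> X then insert a X else X - {a})"

lemma copy_status_mono: "Y \<subseteq> X \<Longrightarrow> copy_status c a Y \<subseteq> copy_status c a X"
  by (auto simp: copy_status_def)

text \<open>Wherever \<open>a\<close> is deleted, \<open>c\<close> remains and imposes the condition
  that \<open>a\<close> would impose with the status of \<open>c\<close>.\<close>

lemma refutes_del_atom_iff:
  assumes "a \<noteq> c"
    and "a |\<in>| H r \<longleftrightarrow> c |\<in>| H r" "a |\<in>| Bpos r \<longleftrightarrow> c |\<in>| Bpos r" "a |\<in>| Bneg r \<longleftrightarrow> c |\<in>| Bneg r"
  shows "refutes Y X (del_atom a r) \<longleftrightarrow> refutes (copy_status c a Y) (copy_status c a X) r"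
proof -
  have meet: "(S - {a}) \<inter> Z = {} \<longleftrightarrow> S \<inter> copy_status c a Z = {}"
    and sub: "S - {a} \<subseteq> Z \<longleftrightarrow> S \<subseteq> copy_status c a Z" if "a \<in> S \<longleftrightarrow> c \<in> S" for S Z
    using that assms(1) by (auto simp: copy_status_def)
  show ?thesis
    using assms(2-4) by (simp add: refutes_def del_atom_def meet sub)
qed

lemma SE_preserving_S_RD_2: "SE_preserving (S_RD 2 :: 'a transformation)"
  unfolding SE_preserving_def
proof (intro allI impI)
  fix P Q P' Q' :: "'a program"
  assume "S_RD 2 (P, Q) (P', Q')" and equiv: "P \<equiv>\<^sub>s\<^sub>s Q"
  then obtain I a where I: "is_indep_set (P @ Q) I" "card I = 2" "a \<in> I"
    and P': "P' = map (del_atom a) P" and Q': "Q' = map (del_atom a) Q"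
    by (auto simp: S_RD_def)
  obtain c where c: "c \<in> I" "a \<noteq> c"
    using I(2,3) by (auto simp: card_2_iff)
  have *: "refutes Y X (del_atom a r) \<longleftrightarrow> refutes (copy_status c a Y) (copy_status c a X) r"
    if "r \<in> set P \<union> set Q" for r Y X
    using that indep_set_same_positions[OF I(1,3) c(1), of r] c(2)
    by (intro refutes_del_atom_iff) auto
  show "P' \<equiv>\<^sub>s\<^sub>s Q'"
    \<comment> \<open>Monotonicity keeps the modified pair ordered, so the equivalence of
      \<open>P\<close> and \<open>Q\<close> applies to it.\<close>
    using equiv copy_status_mono[of _ _ c a] *
    unfolding semi_strong_equiv_iff_refutes P' Q' by simp
qed

lemma S_RD_I:
  assumes "N \<noteq> {}" "N \<subseteq> {..<3 * length (P @ Q)}" "card (indep_set (P @ Q) N) = i"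
    "a \<in> indep_set (P @ Q) N"
  shows "S_RD i (P, Q) (map (del_atom a) P, map (del_atom a) Q)"
  using assms unfolding S_RD_def is_indep_set_def by auto

lemmas small_indep_set_simps =
  indep_set_def comp_sets_def lessThan_Suc numeral_eq_Suc insert_Diff_if

text \<open>The tautology \<open>a \<or> b \<leftarrow> a\<close> is never refuted, but deleting
  \<open>a\<close> leaves the fact \<open>b\<close>.\<close>

lemma not_SE_preserving_S_RD_1:
  assumes "(a :: 'a) \<noteq> b"
  shows "\<not> SE_preserving (S_RD 1 :: 'a transformation)"
proof
  let ?P = "[LPRule {|a, b|} {|a|} {||}]"
  assume "SE_preserving (S_RD 1 :: 'a transformation)"
  moreover have "indep_set (?P @ []) {0, 1} = {a}"
    using assms by (auto simp: small_indep_set_simps)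
  then have "S_RD 1 (?P, []) (map (del_atom a) ?P, map (del_atom a) [])"
    by (intro S_RD_I[of "{0, 1}"]) auto
  moreover have "?P \<equiv>\<^sub>s\<^sub>s []"
    unfolding semi_strong_equiv_iff_refutes by (auto simp: refutes_def)
  ultimately have "map (del_atom a) ?P \<equiv>\<^sub>s\<^sub>s map (del_atom a) []"
    unfolding SE_preserving_def by blast
  then have "\<not> refutes {} {b} (del_atom a (LPRule {|a, b|} {|a|} {||}))"
    unfolding semi_strong_equiv_iff_refutes by simp
  then show False using assms by (auto simp: refutes_def del_atom_def)
qed

text \<open>Deleting \<open>a\<close> from the fact \<open>a\<close> leaves an empty head, which no
  pair refutes.\<close>

lemma not_NSE_preserving_S_RD_1: "\<not> NSE_preserving (S_RD 1 :: 'a transformation)"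
proof
  fix a :: 'a
  let ?P = "[LPRule {|a|} {||} {||}]"
  assume "NSE_preserving (S_RD 1 :: 'a transformation)"
  moreover have "indep_set (?P @ []) {0} = {a}"
    by (auto simp: small_indep_set_simps)
  then have "S_RD 1 (?P, []) (map (del_atom a) ?P, map (del_atom a) [])"
    by (intro S_RD_I[of "{0}"]) auto
  moreover have "map (del_atom a) ?P \<equiv>\<^sub>s\<^sub>s map (del_atom a) []"
    unfolding semi_strong_equiv_iff_refutes by (auto simp: refutes_def del_atom_def)
  ultimately have "?P \<equiv>\<^sub>s\<^sub>s []"
    unfolding NSE_preserving_def by blast
  then have "\<not> refutes {} {a} (LPRule {|a|} {||} {||})"
    unfolding semi_strong_equiv_iff_refutes by simp
  then show False by (auto simp: refutes_def)
qed

text \<open>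
  The fact \<open>d\<close> of \<open>P\<close> is replaced in \<open>Q\<close> by a case distinction. Together with the common rule
  \<open>a \<or> c \<or> d \<leftarrow>\<close> it is exhaustive as long as \<open>a\<close> and \<open>c\<close> have the same status, and so after deleting
  \<open>a\<close>; but it misses the pair \<open>({a}, {a, d})\<close>.
\<close>

lemma not_NSE_preserving_S_RD_2:
  assumes "distinct [a :: 'a, c, d]"
  shows "\<not> NSE_preserving (S_RD 2 :: 'a transformation)"
proof
  let ?P = "[LPRule {|d|} {||} {||}, LPRule {|a, c, d|} {||} {||}]"
  let ?Q = "[LPRule {|d|} {|a, c|} {||}, LPRule {|d|} {||} {|a, c|}, LPRule {|a, c, d|} {||} {||}]"
  assume "NSE_preserving (S_RD 2 :: 'a transformation)"
  \<comment> \<open>The positions of \<open>a\<close> and \<open>c\<close>, three per rule: the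
    heads of both copies of the common rule (3, 12), the positive body (7) and the negative body
    (11) of the case distinction.\<close>
  moreover have "{..<15} - {3, 7, 11, 12} = {0, 1, 2, 4, 5, 6, 8, 9, 10, 13, 14 :: nat}"
    by code_simp
  with assms have "indep_set (?P @ ?Q) {3, 7, 11, 12} = {a, c}"
    by (simp add: indep_set_def comp_sets_def insert_Diff_if)
  then have "S_RD 2 (?P, ?Q) (map (del_atom a) ?P, map (del_atom a) ?Q)"
    using assms by (intro S_RD_I[of "{3, 7, 11, 12}"]) auto
  \<comment> \<open>If a pair refutes the fact \<open>d\<close>, the two cases on \<open>c\<close>
    miss it only when \<open>c\<close> is in \<open>X - Y\<close>; then
    \<open>c \<or> d \<leftarrow>\<close> is refuted.\<close>
  moreover have "map (del_atom a) ?P \<equiv>\<^sub>s\<^sub>s map (del_atom a) ?Q"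
    using assms unfolding semi_strong_equiv_iff_refutes
    by (simp add: refutes_def del_atom_def insert_Diff_if) blast
  ultimately have "?P \<equiv>\<^sub>s\<^sub>s ?Q"
    unfolding NSE_preserving_def by blast
  then have "(\<exists>r\<in>set ?P. refutes {a} {a, d} r) \<longleftrightarrow> (\<exists>r\<in>set ?Q. refutes {a} {a, d} r)"
    unfolding semi_strong_equiv_iff_refutes by (elim allE impE) auto
  then show False using assms by (simp add: refutes_def)
qed

theorem theorem4:
  assumes "infinite (UNIV :: 'a set)"
  shows "\<not> SE_preserving (S_RD 1 :: 'a transformation)
       \<and> \<not> NSE_preserving (S_RD 1 :: 'a transformation)
       \<and> SE_preserving (S_RD 2 :: 'a transformation)
       \<and> \<not> NSE_preserving (S_RD 2 :: 'a transformation)"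
proof -
  obtain A :: "'a set" where "card A = 3"
    using infinite_arbitrarily_large[OF assms] by blast
  then obtain a c d :: 'a where "distinct [a, c, d]"
    by (auto simp: card_3_iff)
  then show ?thesis
    using not_SE_preserving_S_RD_1[of a c] not_NSE_preserving_S_RD_1 SE_preserving_S_RD_2
      not_NSE_preserving_S_RD_2[of a c d] by simp
qed

end
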